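(* Let $S$ be planar simple random walk started at the origin. There exists a positive constant $K$ such that for every positive integer $n$ and every real $r> 0$: (a) $\mathbb{P}\{|S(2n)|\geq r\sqrt{n}\} \leq Ke^{-r^2/4}$; (b) $\mathbb{P}\{\sup_{0\leq t \leq n}|S(2t)| \geq r\sqrt{n}\} \leq 2Ke^{-r^2/4}$.
   Context: Planar simple random walk $S$ is defined by $S(0)=(0,0)$ and $S(n)=\sum_{k=1}^n X_k$ for positive integers $n$, where $X_1,X_2,\dots$ are independent with $\mathbb{P}\{X_k=\pm e_i\}=\frac14$, $i=1,2$, $e_1=(1,0)$, $e_2=(0,1)$. It is extended to real times $t\ge 0$ by linear interpolation: $S(t)=S([t])+(t-[t])(S([t]+1)-S([t]))$, with $[t]$ the integer part of $t$. The supremum is over real $t$. $|\cdot|$ is the Euclidean norm. *)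

theory Defs
  imports "HOL-Probability.Probability"
begin

text \<open>
  The steps are indexed by the positive integers; \<open>X 0\<close> is unconstrained and never used.
  The plane is \<^typ>\<open>real \<times> real\<close>, whose library norm is the Euclidean one.
\<close>

locale planar_srw = prob_space M for M :: "'a measure" +
  fixes X :: "nat \<Rightarrow> 'a \<Rightarrow> real \<times> real"
  assumes indep_steps: "indep_vars (\<lambda>_. borel) X {1..}"
    and step_distribution:
      "\<And>k v. k \<ge> 1 \<Longrightarrow> v \<in> {(1, 0), - (1, 0), (0, 1), - (0, 1)} \<Longrightarrow>
        prob {\<omega> \<in> space M. X k \<omega> = v} = 1 / 4"

definition walk_at :: "(nat \<Rightarrow> 'a \<Rightarrow> real \<times> real) \<Rightarrow> nat \<Rightarrow> 'a \<Rightarrow> real \<times> real" where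
  "walk_at X n \<omega> = (\<Sum>k=1..n. X k \<omega>)"

text \<open>Linear interpolation to real times; only meaningful for \<open>t \<ge> 0\<close>.\<close>

definition walk :: "(nat \<Rightarrow> 'a \<Rightarrow> real \<times> real) \<Rightarrow> real \<Rightarrow> 'a \<Rightarrow> real \<times> real" where
  "walk X t \<omega> = walk_at X (nat \<lfloor>t\<rfloor>) \<omega> +
     (t - of_int \<lfloor>t\<rfloor>) *\<^sub>R (walk_at X (nat \<lfloor>t\<rfloor> + 1) \<omega> - walk_at X (nat \<lfloor>t\<rfloor>) \<omega>)"

end

theory Submission
  imports Defs
begin

text \<open>
  For \<open>N \<ge> 1\<close> the process \<open>exp (\<bar>S(k)\<bar>\<^sup>2 / (N + k) - k / N)\<close> is a supermartingale starting
  at \<open>1\<close>: the four steps average \<open>exp (a \<bullet> X)\<close> to at most \<open>exp (\<bar>a\<bar>\<^sup>2 / 4)\<close>, and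
  \<open>1 / (m + 1) + 1 / (m + 1)\<^sup>2 \<le> 1 / m\<close>. While \<open>k \<le> N\<close>, it is at least
  \<open>exp (R\<^sup>2 / (2 * N) - 1)\<close> whenever \<open>\<bar>S(k)\<bar> \<ge> R\<close>, so the maximal inequality for nonnegative
  supermartingales bounds the probability that the walk leaves the disc of radius \<open>R\<close> up to
  time \<open>N\<close> by \<open>exp (1 - R\<^sup>2 / (2 * N))\<close>. Both claims follow with \<open>N = 2 * n\<close> and \<open>K = e\<close>.
\<close>

section \<open>Exponential moments of a single step\<close>

lemma cosh_le_exp_half_square: "cosh x \<le> exp (x\<^sup>2 / 2)" for x :: real
proof -
  have *: "cosh x \<le> exp (x\<^sup>2 / 2)" if "x \<ge> 0" for x :: real
  proof -
    \<comment> \<open>Hoeffding's estimate for a fair two-point variable with gap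
      \<open>2 * x\<close>; the left side equals \<open>ln (cosh x)\<close>. It is applied for
      nonnegative \<open>x\<close>, and evenness of \<open>cosh\<close> covers the rest.\<close>
    have "- (2 * x) * (1 / 2) + ln (1 + 1 / 2 * (exp (2 * x) - 1)) \<le> (2 * x)\<^sup>2 / 8"
      using Hoeffdings_lemma_aux[of "2 * x" "1 / 2"] that by (simp add: algebra_simps)
    moreover have "1 + 1 / 2 * (exp (2 * x) - 1) = exp x * cosh x"
      by (simp add: cosh_field_def field_simps flip: exp_add)
    ultimately have "ln (cosh x) \<le> x\<^sup>2 / 2"
      by (simp add: ln_mult power_mult_distrib)
    then show ?thesis
      using cosh_real_pos[of x] by (metis exp_le_cancel_iff exp_ln)
  qed
  show ?thesis
    using *[of x] *[of "- x"] by (cases "x \<ge> 0") auto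
qed

abbreviation steps :: "(real \<times> real) set" where
  "steps \<equiv> {(1, 0), - (1, 0), (0, 1), - (0, 1)}"

lemma sum_steps: "sum f steps = f (1, 0) + f (- (1, 0)) + f (0, 1) + f (- (0, 1))"
  for f :: "real \<times> real \<Rightarrow> 'b :: comm_monoid_add"
  by (subst sum.insert, simp, simp)+ (simp add: add.assoc)

lemma norm_steps: "v \<in> steps \<Longrightarrow> norm v = 1"
  by (auto simp: norm_Pair)

text \<open>Rotated by 45 degrees, the two coordinates of a step become independent signs up to
  scale, so the average factors into \<open>cosh ((p + q) / 2) * cosh ((p - q) / 2)\<close>. The
  constant 1/4 is half the variance 1/2 of each original coordinate.\<close>

lemma exp_inner_steps_le:
  fixes a :: "real \<times> real"
  shows "(\<Sum>v\<in>steps. exp (inner a v)) / 4 \<le> exp ((norm a)\<^sup>2 / 4)"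
proof -
  obtain p q where a: "a = (p, q)"
    by (cases a)
  have "(\<Sum>v\<in>steps. exp (inner a v)) / 4 = (cosh p + cosh q) / 2"
    by (simp add: sum_steps a cosh_field_def) (simp add: add_divide_distrib)
  also have "cosh p + cosh q = 2 * (cosh ((p + q) / 2) * cosh ((p - q) / 2))"
    using cosh_add[of "(p + q) / 2" "(p - q) / 2"] cosh_diff[of "(p + q) / 2" "(p - q) / 2"]
    by (simp add: field_simps)
  also have "\<dots> / 2 \<le> exp (((p + q) / 2)\<^sup>2 / 2) * exp (((p - q) / 2)\<^sup>2 / 2)"
    by (simp add: mult_mono cosh_le_exp_half_square)
  also have "\<dots> = exp ((norm a)\<^sup>2 / 4)"
    by (simp add: a norm_Pair power2_eq_square field_simps flip: exp_add)
  finally show ?thesis .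
qed

section \<open>The supermartingale weight\<close>

definition gauss_weight :: "nat \<Rightarrow> nat \<Rightarrow> real \<times> real \<Rightarrow> real" where
  "gauss_weight N k s = exp ((norm s)\<^sup>2 / real (N + k) - real k / real N)"

lemma gauss_weight_pos: "gauss_weight N k s > 0"
  by (simp add: gauss_weight_def)

text \<open>Expanding the squared norm of \<open>s + v\<close> leaves an inner product, whose
  exponential average costs a further \<open>\<alpha>\<^sup>2 * (norm s)\<^sup>2\<close>. The growth
  of the denominator from \<open>m\<close> to \<open>m + 1\<close> pays for this, and the drop
  \<open>1 / N\<close> pays for the \<open>\<alpha>\<close> that comes from the unit length of
  \<open>v\<close>.\<close>

lemma gauss_weight_step:
  assumes "N > 0"
  shows "(\<Sum>v\<in>steps. gauss_weight N (Suc k) (s + v)) / 4 \<le> gauss_weight N k s"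
proof -
  define m where "m = real (N + k)"
  have m: "m > 0" "real N \<le> m"
    using assms by (auto simp: m_def)
  define \<alpha> where "\<alpha> = 1 / (m + 1)"
  define b where "b = real (Suc k) / real N"
  have gw: "gauss_weight N (Suc k) (s + v) =
      exp (\<alpha> * (norm s)\<^sup>2 + \<alpha> - b) * exp (inner ((2 * \<alpha>) *\<^sub>R s) v)" if "v \<in> steps" for v
  proof -
    have "(norm (s + v))\<^sup>2 = (norm s)\<^sup>2 + 2 * inner s v + 1"
      using norm_steps[OF that]
      by (simp add: power2_norm_eq_inner inner_add inner_commute norm_eq_1)
    then show ?thesis
      by (simp add: gauss_weight_def \<alpha>_def b_def m_def add_divide_distrib algebra_simps
          flip: exp_add)
  qed
  have "(\<Sum>v\<in>steps. gauss_weight N (Suc k) (s + v)) / 4 =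
      exp (\<alpha> * (norm s)\<^sup>2 + \<alpha> - b) * ((\<Sum>v\<in>steps. exp (inner ((2 * \<alpha>) *\<^sub>R s) v)) / 4)"
    by (simp only: gw sum_distrib_left times_divide_eq_right cong: sum.cong)
  also have "\<dots> \<le> exp (\<alpha> * (norm s)\<^sup>2 + \<alpha> - b) * exp ((norm ((2 * \<alpha>) *\<^sub>R s))\<^sup>2 / 4)"
    by (intro mult_left_mono exp_inner_steps_le) simp
  also have "\<dots> = exp ((\<alpha> + \<alpha>\<^sup>2) * (norm s)\<^sup>2 + \<alpha> - b)"
    by (simp add: power_mult_distrib algebra_simps flip: exp_add)
  also have "\<dots> \<le> exp ((norm s)\<^sup>2 / m - real k / real N)"
  proof -
    have "\<alpha> + \<alpha>\<^sup>2 \<le> 1 / m"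
      using m by (simp add: \<alpha>_def divide_simps power2_eq_square) (simp add: algebra_simps)
    then have "(\<alpha> + \<alpha>\<^sup>2) * (norm s)\<^sup>2 \<le> 1 / m * (norm s)\<^sup>2"
      by (rule mult_right_mono) simp
    moreover have "\<alpha> \<le> 1 / real N"
      using m assms by (simp add: \<alpha>_def frac_le)
    ultimately show ?thesis
      by (simp add: b_def add_divide_distrib)
  qed
  finally show ?thesis
    by (simp add: gauss_weight_def m_def)
qed

text \<open>Up to time \<open>N\<close> the denominator \<open>N + k\<close> is at most
  \<open>2 * N\<close> and the subtracted drift at most 1; these two facts fix the exponent and the
  factor \<open>e\<close> of the final bound.\<close>

lemma gauss_weight_ge:
  assumes "N > 0" "k \<le> N" "R \<ge> 0" "R \<le> norm s"
  shows "exp (R\<^sup>2 / (2 * real N) - 1) \<le> gauss_weight N k s"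
proof -
  have "R\<^sup>2 / (2 * real N) \<le> (norm s)\<^sup>2 / real (N + k)"
    using assms by (intro frac_le power_mono) auto
  moreover have "real k / real N \<le> 1"
    using assms by simp
  ultimately show ?thesis
    by (simp add: gauss_weight_def)
qed

lemma walk_at_Suc: "walk_at X (Suc k) \<omega> = walk_at X k \<omega> + X (Suc k) \<omega>"
  by (simp add: walk_at_def)

section \<open>Integrating out the next step, and the maximal inequality\<close>

context planar_srw
begin

lemma step_measurable [measurable]: "k \<ge> 1 \<Longrightarrow> X k \<in> borel_measurable M"
  using indep_steps by (auto simp: indep_vars_def)

lemma walk_at_measurable [measurable]: "walk_at X k \<in> borel_measurable M"
  unfolding walk_at_def by (rule borel_measurable_sum) auto

text \<open>The four prescribed point probabilities add up to 1, so almost surely the step takes no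
  other value.\<close>

lemma nn_integral_step:
  fixes f :: "real \<times> real \<Rightarrow> ennreal"
  assumes k: "k \<ge> 1" and [measurable]: "f \<in> borel_measurable borel"
  shows "(\<integral>\<^sup>+\<omega>. f (X k \<omega>) \<partial>M) = (\<Sum>v\<in>steps. f v * ennreal (1 / 4))"
proof -
  have [measurable]: "X k \<in> borel_measurable M"
    using k by simp
  have "prob (\<Union>v\<in>steps. {\<omega> \<in> space M. X k \<omega> = v}) =
      (\<Sum>v\<in>steps. prob {\<omega> \<in> space M. X k \<omega> = v})"
    by (rule finite_measure_finite_Union) (auto simp: disjoint_family_on_def)
  also have "\<dots> = (\<Sum>v\<in>steps. 1 / 4)"
    by (intro sum.cong refl step_distribution k)
  also have "\<dots> = 1"
    by (simp add: sum_steps)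
  finally have "AE \<omega> in M. \<omega> \<in> (\<Union>v\<in>steps. {\<omega> \<in> space M. X k \<omega> = v})"
    by (subst (asm) prob_eq_1) auto
  then have AE: "AE \<omega> in M. X k \<omega> \<in> steps"
    by eventually_elim blast
  have "(\<integral>\<^sup>+\<omega>. f (X k \<omega>) \<partial>M) =
      (\<integral>\<^sup>+\<omega>. (\<Sum>v\<in>steps. f v * indicator {\<omega> \<in> space M. X k \<omega> = v} \<omega>) \<partial>M)"
    by (rule nn_integral_cong_AE, use AE AE_space in eventually_elim)
      (auto simp: sum_steps indicator_def)
  also have "\<dots> = (\<Sum>v\<in>steps. f v * emeasure M {\<omega> \<in> space M. X k \<omega> = v})"
    by (subst nn_integral_sum, simp, intro sum.cong refl nn_integral_cmult_indicator) measurable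
  also have "\<dots> = (\<Sum>v\<in>steps. f v * ennreal (1 / 4))"
    by (intro sum.cong refl arg_cong2[where f = "(*)"])
      (simp only: emeasure_eq_measure step_distribution[OF k])
  finally show ?thesis .
qed

text \<open>This stands in for conditional expectation given the history: independence makes the
  joint law a product, and Tonelli's theorem allows the new step to be averaged with the history
  held fixed.\<close>

lemma nn_integral_history_step:
  fixes g :: "(nat \<Rightarrow> real \<times> real) \<times> (real \<times> real) \<Rightarrow> ennreal"
  assumes J: "J \<subseteq> {1..}" "k \<ge> 1" "k \<notin> J"
    and g [measurable]: "g \<in> borel_measurable (PiM J (\<lambda>_. borel) \<Otimes>\<^sub>M borel)"
  shows "(\<integral>\<^sup>+\<omega>. g (restrict (\<lambda>i. X i \<omega>) J, X k \<omega>) \<partial>M) =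
    (\<integral>\<^sup>+\<omega>. (\<Sum>v\<in>steps. g (restrict (\<lambda>i. X i \<omega>) J, v) * ennreal (1 / 4)) \<partial>M)"
proof -
  let ?P = "PiM J (\<lambda>_. borel :: (real \<times> real) measure)"
  let ?H = "\<lambda>\<omega>. restrict (\<lambda>i. X i \<omega>) J"
  \<comment> \<open>Independence is available for blocks of coordinates, so the single step is
    carried as a function on \<open>{k}\<close> and evaluated at \<open>k\<close>.\<close>
  let ?Q = "PiM {k} (\<lambda>_. borel :: (real \<times> real) measure)"
  let ?L = "\<lambda>\<omega>. restrict (\<lambda>i. X i \<omega>) {k}"
  have "indep_var ?P ?H ?Q ?L"
    by (rule indep_var_restrict[OF indep_steps]) (use J in auto)
  then have [measurable]: "?H \<in> measurable M ?P" "?L \<in> measurable M ?Q"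
    and distr: "distr M (?P \<Otimes>\<^sub>M ?Q) (\<lambda>\<omega>. (?H \<omega>, ?L \<omega>)) = distr M ?P ?H \<Otimes>\<^sub>M distr M ?Q ?L"
    by (auto simp: indep_var_distribution_eq)
  interpret L: prob_space "distr M ?Q ?L"
    by (rule prob_space_distr) simp
  have [measurable]: "(\<lambda>(h, l). g (h, l k)) \<in> borel_measurable (?P \<Otimes>\<^sub>M ?Q)"
    unfolding case_prod_unfold by measurable
  have "(\<integral>\<^sup>+\<omega>. g (?H \<omega>, X k \<omega>) \<partial>M) =
      (\<integral>\<^sup>+z. (case z of (h, l) \<Rightarrow> g (h, l k)) \<partial>(distr M ?P ?H \<Otimes>\<^sub>M distr M ?Q ?L))"
    by (subst distr[symmetric], subst nn_integral_distr) auto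
  also have "\<dots> = (\<integral>\<^sup>+h. \<integral>\<^sup>+l. g (h, l k) \<partial>distr M ?Q ?L \<partial>distr M ?P ?H)"
    by (subst L.nn_integral_fst[symmetric]) (simp_all cong: measurable_cong_sets)
  also have "\<dots> = (\<integral>\<^sup>+h. (\<Sum>v\<in>steps. g (h, v) * ennreal (1 / 4)) \<partial>distr M ?P ?H)"
  proof (intro nn_integral_cong)
    fix h assume "h \<in> space (distr M ?P ?H)"
    then have "h \<in> space ?P"
      by simp
    from measurable_compose[OF measurable_Pair1'[OF this] g]
    have [measurable]: "(\<lambda>x. g (h, x)) \<in> borel_measurable borel" .
    have "(\<integral>\<^sup>+l. g (h, l k) \<partial>distr M ?Q ?L) = (\<integral>\<^sup>+\<omega>. g (h, X k \<omega>) \<partial>M)"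
      by (subst nn_integral_distr) simp_all
    also have "\<dots> = (\<Sum>v\<in>steps. g (h, v) * ennreal (1 / 4))"
      by (rule nn_integral_step[OF J(2)]) measurable
    finally show "(\<integral>\<^sup>+l. g (h, l k) \<partial>distr M ?Q ?L) = (\<Sum>v\<in>steps. g (h, v) * ennreal (1 / 4))" .
  qed
  also have "\<dots> = (\<integral>\<^sup>+\<omega>. (\<Sum>v\<in>steps. g (?H \<omega>, v) * ennreal (1 / 4)) \<partial>M)"
    by (subst nn_integral_distr) auto
  finally show ?thesis .
qed

lemma prob_exit_disc_le:
  assumes N: "N > 0" and R: "R > 0"
  shows "prob {\<omega> \<in> space M. \<exists>k\<le>N. R \<le> norm (walk_at X k \<omega>)} \<le> exp 1 * exp (- R\<^sup>2 / (2 * real N))"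
proof -
  define c where "c = exp (R\<^sup>2 / (2 * real N) - 1)"
  define V where "V = (\<lambda>k \<omega>. if \<exists>j\<le>k. R \<le> norm (walk_at X j \<omega>) then c
    else gauss_weight N k (walk_at X k \<omega>))"
  have V_step: "(\<integral>\<^sup>+\<omega>. V (Suc k) \<omega> \<partial>M) \<le> (\<integral>\<^sup>+\<omega>. V k \<omega> \<partial>M)" if "Suc k \<le> N" for k
  proof -
    let ?H = "\<lambda>\<omega>. restrict (\<lambda>i. X i \<omega>) {1..k}"
    \<comment> \<open>The value at time \<open>Suc k\<close> if only exits up to time
      \<open>k\<close> freeze the process: a function of the history and one fresh step.\<close>
    define g where "g = (\<lambda>(h, x). if \<exists>j\<in>{..k}. R \<le> norm (\<Sum>i\<in>{1..j}. h i :: real \<times> real) then c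
      else gauss_weight N (Suc k) ((\<Sum>i=1..k. h i) + x))"
    have [measurable]: "(\<lambda>z. \<Sum>i\<in>{1..j}. fst z i) \<in> borel_measurable
        (PiM {1..k} (\<lambda>_. borel :: (real \<times> real) measure) \<Otimes>\<^sub>M (borel :: (real \<times> real) measure))"
      if "j \<in> {..k}" for j
      by (rule borel_measurable_sum, rule measurable_compose[OF measurable_fst],
          rule measurable_component_singleton) (use that in auto)
    have g_measurable: "g \<in> borel_measurable (PiM {1..k} (\<lambda>_. borel) \<Otimes>\<^sub>M borel)"
      unfolding g_def gauss_weight_def case_prod_unfold by measurable
    have g_H: "g (?H \<omega>, x) = (if \<exists>j\<le>k. R \<le> norm (walk_at X j \<omega>) then c
        else gauss_weight N (Suc k) (walk_at X k \<omega> + x))" for \<omega> x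
      unfolding g_def by (auto simp: walk_at_def)
    \<comment> \<open>The two sides can differ only if the first exit happens exactly at
      \<open>Suc k\<close>; there the weight is at least \<open>c\<close>, because
      \<open>Suc k \<le> N\<close>.\<close>
    have "V (Suc k) \<omega> \<le> g (?H \<omega>, X (Suc k) \<omega>)" for \<omega>
      using gauss_weight_ge[OF N that less_imp_le[OF R], of "walk_at X (Suc k) \<omega>"]
      unfolding V_def g_H by (auto simp: c_def walk_at_Suc le_Suc_eq)
    then have "(\<integral>\<^sup>+\<omega>. V (Suc k) \<omega> \<partial>M) \<le> (\<integral>\<^sup>+\<omega>. g (?H \<omega>, X (Suc k) \<omega>) \<partial>M)"
      by (intro nn_integral_mono ennreal_leI)
    also have "\<dots> = (\<integral>\<^sup>+\<omega>. (\<Sum>v\<in>steps. ennreal (g (?H \<omega>, v)) * ennreal (1 / 4)) \<partial>M)"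
      by (rule nn_integral_history_step[OF _ _ _ measurable_compose[OF g_measurable measurable_ennreal]])
        auto
    also have "\<dots> \<le> (\<integral>\<^sup>+\<omega>. V k \<omega> \<partial>M)"
    proof (rule nn_integral_mono)
      fix \<omega>
      have g_nonneg: "g (?H \<omega>, v) \<ge> 0" for v
        unfolding g_H using gauss_weight_pos by (simp add: c_def less_imp_le)
      have "(\<Sum>v\<in>steps. ennreal (g (?H \<omega>, v)) * ennreal (1 / 4)) =
          ennreal ((\<Sum>v\<in>steps. g (?H \<omega>, v)) / 4)"
        using g_nonneg
        by (simp add: sum_ennreal sum_divide_distrib flip: ennreal_mult del: sum.insert)
      also have "(\<Sum>v\<in>steps. g (?H \<omega>, v)) / 4 \<le> V k \<omega>"
      proof (cases "\<exists>j\<le>k. R \<le> norm (walk_at X j \<omega>)")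
        case True
        then show ?thesis
          unfolding g_H V_def by (simp add: sum_steps)
      next
        case False
        then show ?thesis
          unfolding g_H V_def by (simp only: if_False gauss_weight_step[OF N])
      qed
      finally show "(\<Sum>v\<in>steps. ennreal (g (?H \<omega>, v)) * ennreal (1 / 4)) \<le> ennreal (V k \<omega>)"
        by (simp add: ennreal_leI)
    qed
    finally show ?thesis .
  qed
  have V_le: "(\<integral>\<^sup>+\<omega>. V k \<omega> \<partial>M) \<le> 1" if "k \<le> N" for k
    using that
  proof (induction k)
    case 0
    \<comment> \<open>As \<open>R > 0\<close>, the origin does not count as an exit, and its weight
      at time 0 is \<open>exp 0\<close>.\<close>
    then show ?case
      using R by (simp add: V_def walk_at_def gauss_weight_def emeasure_space_1)
  next
    case (Suc k)
    then show ?case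
      using V_step[of k] by auto
  qed
  let ?A = "{\<omega> \<in> space M. \<exists>k\<le>N. R \<le> norm (walk_at X k \<omega>)}"
  have [measurable]: "?A \<in> sets M"
    by measurable
  \<comment> \<open>Markov's inequality: on \<open>?A\<close> the process has been frozen at
    \<open>c\<close> by time \<open>N\<close>.\<close>
  have "ennreal (c * prob ?A) = (\<integral>\<^sup>+\<omega>. ennreal c * indicator ?A \<omega> \<partial>M)"
    by (simp add: nn_integral_cmult_indicator emeasure_eq_measure ennreal_mult c_def)
  also have "\<dots> \<le> (\<integral>\<^sup>+\<omega>. V N \<omega> \<partial>M)"
    by (intro nn_integral_mono) (auto simp: V_def indicator_def)
  also have "\<dots> \<le> 1"
    by (rule V_le) simp
  finally have "c * prob ?A \<le> 1"
    by simp
  then have "prob ?A \<le> 1 / c"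
    by (simp add: c_def field_simps)
  also have "1 / c = exp 1 * exp (- R\<^sup>2 / (2 * real N))"
    by (simp add: c_def exp_diff exp_minus field_simps)
  finally show ?thesis .
qed

end

section \<open>From integer to real times\<close>

lemma walk_of_nat: "walk X (real k) \<omega> = walk_at X k \<omega>"
  by (simp add: walk_def)

text \<open>Between integer times the path runs along a segment, and balls are convex.\<close>

lemma norm_walk_le:
  assumes "\<And>k. k \<le> N \<Longrightarrow> norm (walk_at X k \<omega>) \<le> B" and t: "0 \<le> t" "t \<le> real N"
  shows "norm (walk X t \<omega>) \<le> B"
\<comment> \<open>At \<open>t = N\<close> the interpolation formula mentions time
  \<open>N + 1\<close>, which the hypothesis does not cover.\<close>
proof (cases "t = real N")
  case True
  then show ?thesis
    using assms by (simp add: walk_of_nat)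
next
  case False
  let ?k = "nat \<lfloor>t\<rfloor>"
  let ?u = "t - of_int \<lfloor>t\<rfloor>"
  have k: "?k + 1 \<le> N"
    using False t by linarith
  have u: "0 \<le> ?u" "?u \<le> 1"
    by linarith+
  have "walk X t \<omega> = (1 - ?u) *\<^sub>R walk_at X ?k \<omega> + ?u *\<^sub>R walk_at X (?k + 1) \<omega>"
    unfolding walk_def by (simp add: algebra_simps)
  also have "\<dots> \<in> cball 0 B"
    using u assms(1)[of ?k] assms(1)[of "?k + 1"] k
    by (intro convexD[OF convex_cball]) (auto simp: dist_norm)
  finally show ?thesis
    by simp
qed

text \<open>The supremum is bounded by a maximum over finitely many integer times, which is
  attained.\<close>

lemma SUP_norm_walk_geD:
  assumes "r \<le> (SUP t\<in>{0..real n}. norm (walk X (2 * t) \<omega>))"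
  shows "\<exists>k\<le>2 * n. r \<le> norm (walk_at X k \<omega>)"
proof -
  define B where "B = Max ((\<lambda>k. norm (walk_at X k \<omega>)) ` {..2 * n})"
  have "norm (walk_at X k \<omega>) \<le> B" if "k \<le> 2 * n" for k
    unfolding B_def using that by (intro Max_ge) auto
  then have "(SUP t\<in>{0..real n}. norm (walk X (2 * t) \<omega>)) \<le> B"
    by (intro cSUP_least norm_walk_le[where N = "2 * n"]) auto
  moreover have "B \<in> (\<lambda>k. norm (walk_at X k \<omega>)) ` {..2 * n}"
    unfolding B_def by (intro Max_in) auto
  ultimately show ?thesis
    using assms by auto
qed

theorem lemma3p6:
  fixes M :: "'a measure" and X :: "nat \<Rightarrow> 'a \<Rightarrow> real \<times> real"
  assumes "planar_srw M X"
  shows "\<exists>K::real. K > 0 \<and> (\<forall>(n::nat) (r::real). n > 0 \<longrightarrow> r > 0 \<longrightarrow>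
    measure M {\<omega> \<in> space M. norm (walk X (2 * real n) \<omega>) \<ge> r * sqrt (real n)}
      \<le> K * exp (- (r\<^sup>2) / 4) \<and>
    measure M {\<omega> \<in> space M. (SUP t\<in>{0..real n}. norm (walk X (2 * t) \<omega>)) \<ge> r * sqrt (real n)}
      \<le> 2 * K * exp (- (r\<^sup>2) / 4))"
proof (intro exI[of _ "exp 1"] conjI allI impI)
  interpret planar_srw M X
    by fact
  fix n :: nat and r :: real
  assume n: "n > 0" and r: "r > 0"
  let ?A = "{\<omega> \<in> space M. \<exists>k\<le>2 * n. r * sqrt (real n) \<le> norm (walk_at X k \<omega>)}"
  \<comment> \<open>Two steps per unit of time give \<open>N = 2 * n\<close>, so the exponent is
    \<open>r\<^sup>2 * n / (4 * n)\<close> up to sign.\<close>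
  have eq: "- (r * sqrt (real n))\<^sup>2 / (2 * real (2 * n)) = - (r\<^sup>2) / 4"
    using n by (simp add: power_mult_distrib)
  have A: "measure M ?A \<le> exp 1 * exp (- (r\<^sup>2) / 4)"
    using prob_exit_disc_le[of "2 * n" "r * sqrt (real n)", unfolded eq] n r by simp
  have [measurable]: "?A \<in> sets M"
    by measurable
  have "walk X (2 * real n) \<omega> = walk_at X (2 * n) \<omega>" for \<omega>
    using walk_of_nat[of X "2 * n"] by simp
  then have "measure M {\<omega> \<in> space M. norm (walk X (2 * real n) \<omega>) \<ge> r * sqrt (real n)} \<le> measure M ?A"
    by (intro finite_measure_mono) auto
  with A show "measure M {\<omega> \<in> space M. norm (walk X (2 * real n) \<omega>) \<ge> r * sqrt (real n)}
      \<le> exp 1 * exp (- (r\<^sup>2) / 4)"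
    by simp
  have "measure M {\<omega> \<in> space M. (SUP t\<in>{0..real n}. norm (walk X (2 * t) \<omega>)) \<ge> r * sqrt (real n)}
      \<le> measure M ?A"
    by (intro finite_measure_mono) (auto dest: SUP_norm_walk_geD)
  also have "\<dots> \<le> 2 * exp 1 * exp (- (r\<^sup>2) / 4)"
    using A by (rule order_trans) simp
  finally show "measure M {\<omega> \<in> space M. (SUP t\<in>{0..real n}. norm (walk X (2 * t) \<omega>)) \<ge> r * sqrt (real n)}
      \<le> 2 * exp 1 * exp (- (r\<^sup>2) / 4)" .
qed simp

end
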